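(* Let $\mathcal{E}=\mathcal{E}_{C,F}$ be a 1-dimensional exponential family defined over a finite set $\Omega=\{x_0,\dots,x_m\}$, with reduced exponential family $\mathcal{E}_{red}$ defined over $\Omega_{red}$. The following are equivalent. (i) The scalar curvature of $T\mathcal{E}$ is constant. (ii) $\mathcal{E}_{red}\sim\mathcal{B}(p)$, where $p+1$ is the cardinality of $\Omega_{red}$.
   Context: For a finite set $\Omega=\{x_0,\dots,x_m\}$ (with the counting measure) and functions $C,F:\Omega\to\mathbb{R}$ with $F$ linearly independent from the constant function $1$ (i.e. $F$ not constant), $\mathcal{E}_{C,F}$ denotes the 1-dimensional exponential family over $\Omega$ with elements $p_{C,F}(x;\theta)=\exp\{C(x)+\theta F(x)-\psi_{C,F}(\theta)\}$, $\theta\in\mathbb{R}$, where $\psi_{C,F}(\theta)=\ln\big(\sum_{k=0}^m\exp(C(x_k)+\theta F(x_k))\big)$. The parameter $\theta$ is a global chart, making $\mathcal{E}_{C,F}$ a 1-dimensional manifold. Equivalence: two 1-dimensional exponential families $\mathcal{E}_{C,F}$, $\mathcal{E}_{C',F'}$ over the same finite set $\Omega$ are equivalent, written $\mathcal{E}_{C,F}\sim\mathcal{E}_{C',F'}$, if the sets of functions $\{p_{C,F}(\cdot\,;\theta):\Omega\to\mathbb{R}\}_{\theta\in\mathbb{R}}$ and $\{p_{C',F'}(\cdot\,;\theta):\Omega\to\mathbb{R}\}_{\theta\in\mathbb{R}}$ coincide. Reduced family: let $\alpha_0<\dots<\alpha_p$ be such that $\mathrm{Im}(F)=\{\alpha_0,\dots,\alpha_p\}$,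 and define $\omega_i\in\mathbb{R}$ by $e^{\omega_i}=\sum_{x\in F^{-1}(\alpha_i)}e^{C(x)}$ for $i=0,\dots,p$. Put $\Omega_{red}=\{0,1,\dots,p\}$, $F_{red}(k)=\alpha_k$, $C_{red}(k)=\omega_k$. Then $\mathcal{E}_{red}:=\mathcal{E}_{C_{red},F_{red}}$, a 1-dimensional exponential family over $\Omega_{red}$. Binomial family: $\mathcal{B}(n)$ is the set of binomial distributions $k\mapsto\binom{n}{k}q^k(1-q)^{n-k}$ on $\{0,\dots,n\}$, $q\in(0,1)$. It is the exponential family with $C(k)=\ln\binom{n}{k}$, $F(k)=k$, $\theta=\ln\frac{q}{1-q}$, $\psi(\theta)=n\ln(1+e^\theta)$. Scalar curvature of $T\mathcal{E}$: the Fisher metric on $\mathcal{E}$ is $h_F(\theta)=\sum_{x\in\Omega}(\partial_\theta\ln p_{C,F}(x;\theta))^2p_{C,F}(x;\theta)=\psi_{C,F}''(\theta)$. The exponential connection $\nabla^{(e)}$ is the flat connection for which $\theta$ is an affine coordinate. Let $(q,r)$ be the coordinates on $T\mathcal{E}$ for which $(q,r)$ represents the tangent vector $r\,\frac{\partial}{\partial\theta}$ at $\theta=q$. The Kähler metric on $T\mathcal{E}$ associated to $(h_F,\nabla^{(e)})$ by Dombrowski's construction is $g=h_F(q)(dq^2+dr^2)$. The scalar curvature of $T\mathcal{E}$ is that (trace of the Ricci tensor) of $g$; explicitly $\mathrm{Scal}(q,r)=-\frac{1}{h_F(q)}\frac{d^2}{dq^2}\ln h_F(q)$. *)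

theory Defs
  imports "HOL-Probability.Probability"
begin

section \<open>One-dimensional exponential families over finite sets\<close>

text \<open>
  A family is represented by its data: the sample space \<open>\<Omega>\<close> and the functions \<open>C\<close> and \<open>F\<close>, of which
  only the restrictions to \<open>\<Omega>\<close> matter. The parameter \<open>\<theta>\<close> ranges over all reals.
\<close>

record 'a exp_family =
  ef_space :: "'a set"
  ef_C :: "'a \<Rightarrow> real"
  ef_F :: "'a \<Rightarrow> real"

text \<open>Non-constancy of \<open>F\<close> is linear independence from the function 1; it forces \<open>\<Omega> \<noteq> {}\<close>.\<close>

definition is_exp_family :: "'a exp_family \<Rightarrow> bool" where
  "is_exp_family E \<longleftrightarrow> finite (ef_space E) \<and> \<not> ef_F E constant_on ef_space E"

definition ef_psi :: "'a exp_family \<Rightarrow> real \<Rightarrow> real" where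
  "ef_psi E \<theta> = ln (\<Sum>x\<in>ef_space E. exp (ef_C E x + \<theta> * ef_F E x))"

definition ef_prob :: "'a exp_family \<Rightarrow> real \<Rightarrow> 'a \<Rightarrow> real" where
  "ef_prob E \<theta> x = exp (ef_C E x + \<theta> * ef_F E x - ef_psi E \<theta>)"

text \<open>
  The elements of the family as functions on \<open>\<Omega>\<close>; the restriction makes equality of
  two such functions mean agreement on \<open>\<Omega>\<close>.
\<close>

definition ef_distributions :: "'a exp_family \<Rightarrow> ('a \<Rightarrow> real) set" where
  "ef_distributions E = range (\<lambda>\<theta>. restrict (ef_prob E \<theta>) (ef_space E))"

definition ef_equiv :: "'a exp_family \<Rightarrow> 'a exp_family \<Rightarrow> bool" where
  "ef_equiv E E' \<longleftrightarrow>
     ef_space E = ef_space E' \<and> ef_distributions E = ef_distributions E'"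


subsection \<open>The reduced family\<close>

text \<open>\<open>ef_alpha E k\<close> is the \<open>k\<close>-th smallest value of \<open>F\<close> on \<open>\<Omega>\<close>, counting from 0.\<close>

definition ef_alpha :: "'a exp_family \<Rightarrow> nat \<Rightarrow> real" where
  "ef_alpha E k = sorted_list_of_set (ef_F E ` ef_space E) ! k"

definition ef_omega :: "'a exp_family \<Rightarrow> nat \<Rightarrow> real" where
  "ef_omega E k = ln (\<Sum>x\<in>{x\<in>ef_space E. ef_F E x = ef_alpha E k}. exp (ef_C E x))"

definition reduced_family :: "'a exp_family \<Rightarrow> nat exp_family" where
  "reduced_family E =
     \<lparr>ef_space = {..<card (ef_F E ` ef_space E)}, ef_C = ef_omega E, ef_F = ef_alpha E\<rparr>"

lemma ef_alpha_strict_mono: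
  assumes "finite (ef_space E)"
  shows "strict_mono_on {..<card (ef_F E ` ef_space E)} (ef_alpha E)"
  unfolding strict_mono_on_def ef_alpha_def
  by (auto intro!: sorted_wrt_nth_less[OF sorted_list_of_set.strict_sorted_key_list_of_set])

lemma ef_alpha_image:
  assumes "finite (ef_space E)"
  shows "ef_alpha E ` {..<card (ef_F E ` ef_space E)} = ef_F E ` ef_space E"
proof -
  let ?L = "sorted_list_of_set (ef_F E ` ef_space E)"
  have "set ?L = ef_F E ` ef_space E" "length ?L = card (ef_F E ` ef_space E)"
    using assms by auto
  moreover have "set ?L = (!) ?L ` {..<length ?L}"
    by (auto simp: set_conv_nth)
  ultimately show ?thesis
    unfolding ef_alpha_def by simp
qed

lemma exp_ef_omega:
  assumes "finite (ef_space E)" and "k < card (ef_F E ` ef_space E)"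
  shows "exp (ef_omega E k) = (\<Sum>x\<in>{x\<in>ef_space E. ef_F E x = ef_alpha E k}. exp (ef_C E x))"
proof -
  have "ef_alpha E k \<in> ef_F E ` ef_space E"
    using ef_alpha_image[OF assms(1)] assms(2) by blast
  then have "{x\<in>ef_space E. ef_F E x = ef_alpha E k} \<noteq> {}"
    by auto
  then have "(\<Sum>x\<in>{x\<in>ef_space E. ef_F E x = ef_alpha E k}. exp (ef_C E x)) > 0"
    using assms(1) by (intro sum_pos) auto
  then show ?thesis
    unfolding ef_omega_def by simp
qed


subsection \<open>The binomial family\<close>

definition binomial_family :: "nat \<Rightarrow> nat exp_family" where
  "binomial_family n =
     \<lparr>ef_space = {..n}, ef_C = (\<lambda>k. ln (real (n choose k))), ef_F = real\<rparr>"

lemma ef_psi_binomial_family: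
  "ef_psi (binomial_family n) \<theta> = real n * ln (1 + exp \<theta>)"
proof -
  have "(\<Sum>k\<le>n. exp (ln (real (n choose k)) + \<theta> * real k))
      = (\<Sum>k\<le>n. real (n choose k) * exp \<theta> ^ k * 1 ^ (n - k))"
    by (intro sum.cong refl) (auto simp: exp_add exp_of_nat2_mult)
  also have "\<dots> = (exp \<theta> + 1) ^ n"
    by (rule binomial_ring[symmetric])
  finally show ?thesis
    by (simp add: ef_psi_def binomial_family_def ln_realpow add.commute add_pos_pos)
qed

text \<open>Its elements are the binomial distributions with success probability in \<open>(0, 1)\<close>.\<close>

lemma ef_distributions_binomial_family:
  "ef_distributions (binomial_family n) =
     (\<lambda>q. restrict (pmf (binomial_pmf n q)) {..n}) ` {0<..<1}"
proof -
  have eq: "restrict (ef_prob (binomial_family n) \<theta>) (ef_space (binomial_family n))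
        = restrict (pmf (binomial_pmf n (exp \<theta> / (1 + exp \<theta>)))) {..n}" for \<theta>
  proof -
    have pos: "1 + exp \<theta> > 0" by (simp add: add_pos_pos)
    have q: "0 \<le> exp \<theta> / (1 + exp \<theta>)" "exp \<theta> / (1 + exp \<theta>) \<le> 1"
      using pos by auto
    have q': "1 - exp \<theta> / (1 + exp \<theta>) = 1 / (1 + exp \<theta>)"
      using pos by (simp add: field_simps)
    have "ef_prob (binomial_family n) \<theta> k = pmf (binomial_pmf n (exp \<theta> / (1 + exp \<theta>))) k"
      if "k \<le> n" for k
    proof -
      have "ef_prob (binomial_family n) \<theta> k
          = real (n choose k) * exp \<theta> ^ k / (1 + exp \<theta>) ^ n"
        using that pos unfolding ef_prob_def ef_psi_binomial_family
        by (simp add: binomial_family_def exp_diff exp_add exp_of_nat_mult exp_of_nat2_mult)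
      also have "(1 + exp \<theta>) ^ n = (1 + exp \<theta>) ^ k * (1 + exp \<theta>) ^ (n - k)"
        using that by (simp flip: power_add)
      finally show ?thesis
        by (simp add: pmf_binomial[OF q] q' power_divide)
    qed
    then show ?thesis
      by (auto simp: binomial_family_def restrict_def fun_eq_iff)
  qed
  have "range (\<lambda>\<theta>. exp \<theta> / (1 + exp \<theta>)) = {0<..<1 :: real}"
  proof (intro equalityI subsetI)
    fix q :: real assume "q \<in> range (\<lambda>\<theta>. exp \<theta> / (1 + exp \<theta>))"
    then show "q \<in> {0<..<1}" by (auto simp: field_simps add_pos_pos)
  next
    fix q :: real assume "q \<in> {0<..<1}"
    then have "q = exp (ln (q / (1 - q))) / (1 + exp (ln (q / (1 - q))))"
      by (simp add: field_simps)
    then show "q \<in> range (\<lambda>\<theta>. exp \<theta> / (1 + exp \<theta>))" by (rule range_eqI)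
  qed
  then have "(\<lambda>q. restrict (pmf (binomial_pmf n q)) {..n}) ` {0<..<1}
      = range (\<lambda>\<theta>. restrict (pmf (binomial_pmf n (exp \<theta> / (1 + exp \<theta>)))) {..n})"
    by (metis (no_types, lifting) image_cong image_image)
  then show ?thesis
    unfolding ef_distributions_def eq by simp
qed


section \<open>Scalar curvature\<close>

text \<open>
  A Riemannian metric in a global chart is given by its coefficient matrix \<open>g z\<close> at each
  coordinate vector \<open>z\<close>.
\<close>

definition partial_deriv :: "'n::finite \<Rightarrow> (real^'n \<Rightarrow> real) \<Rightarrow> real^'n \<Rightarrow> real" where
  "partial_deriv i f z = deriv (\<lambda>t. f (z + t *\<^sub>R axis i 1)) 0"

text \<open>\<open>christoffel g k i j\<close> is \<open>\<Gamma>\<^sup>k\<^sub>i\<^sub>j\<close>, i.e. \<open>\<nabla>\<^bsub>\<partial>i\<^esub> \<partial>\<^sub>j = (\<Sum>k. \<Gamma>\<^sup>k\<^sub>i\<^sub>j \<partial>\<^sub>k)\<close>.\<close>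

definition christoffel ::
  "(real^'n \<Rightarrow> real^'n^'n) \<Rightarrow> 'n::finite \<Rightarrow> 'n \<Rightarrow> 'n \<Rightarrow> real^'n \<Rightarrow> real" where
  "christoffel g k i j z = 1 / 2 * (\<Sum>l\<in>UNIV. matrix_inv (g z) $ k $ l *
      (partial_deriv i (\<lambda>w. g w $ j $ l) z + partial_deriv j (\<lambda>w. g w $ i $ l) z
        - partial_deriv l (\<lambda>w. g w $ i $ j) z))"

text \<open>
  \<open>riemann g l k i j\<close> is the coefficient of \<open>\<partial>\<^sub>l\<close> in \<open>R(\<partial>\<^sub>i, \<partial>\<^sub>j) \<partial>\<^sub>k\<close>, where
  \<open>R(X, Y) = [\<nabla>\<^sub>X, \<nabla>\<^sub>Y] - \<nabla>\<^bsub>[X, Y]\<^esub>\<close>; \<open>Ric(Y, Z)\<close> is the trace of \<open>X \<mapsto> R(X, Y) Z\<close>.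
\<close>

definition riemann ::
  "(real^'n \<Rightarrow> real^'n^'n) \<Rightarrow> 'n::finite \<Rightarrow> 'n \<Rightarrow> 'n \<Rightarrow> 'n \<Rightarrow> real^'n \<Rightarrow> real" where
  "riemann g l k i j z =
     partial_deriv i (christoffel g l j k) z - partial_deriv j (christoffel g l i k) z
     + (\<Sum>m\<in>UNIV. christoffel g l i m z * christoffel g m j k z
                 - christoffel g l j m z * christoffel g m i k z)"

definition ricci ::
  "(real^'n \<Rightarrow> real^'n^'n) \<Rightarrow> 'n::finite \<Rightarrow> 'n \<Rightarrow> real^'n \<Rightarrow> real" where
  "ricci g j k z = (\<Sum>i\<in>UNIV. riemann g i k i j z)"

definition scalar_curvature :: "(real^'n::finite \<Rightarrow> real^'n^'n) \<Rightarrow> real^'n \<Rightarrow> real" where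
  "scalar_curvature g z = (\<Sum>j\<in>UNIV. \<Sum>k\<in>UNIV. matrix_inv (g z) $ j $ k * ricci g j k z)"


subsection \<open>The tangent bundle of an exponential family\<close>

definition fisher_metric :: "'a exp_family \<Rightarrow> real \<Rightarrow> real" where
  "fisher_metric E \<theta> =
     (\<Sum>x\<in>ef_space E. (deriv (\<lambda>t. ln (ef_prob E t x)) \<theta>)\<^sup>2 * ef_prob E \<theta> x)"

text \<open>
  In the global chart \<open>z = (q, r)\<close>, standing for the tangent vector \<open>r \<partial>/\<partial>\<theta>\<close> at \<open>\<theta> = q\<close>, Dombrowski's
  metric for the Fisher metric \<open>h\<close> and the exponential connection is \<open>h(q) (dq\<^sup>2 + dr\<^sup>2)\<close>: the
  Christoffel symbol of the connection vanishes in the affine coordinate \<open>\<theta>\<close>, so that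
  \<open>\<partial>/\<partial>q\<close> is horizontal. Here \<open>mat c\<close> is \<open>c\<close> times the identity matrix.
\<close>

definition tangent_bundle_metric :: "'a exp_family \<Rightarrow> real^2 \<Rightarrow> real^2^2" where
  "tangent_bundle_metric E z = mat (fisher_metric E (z $ 1))"

lemma partial_deriv_fst:
  fixes z :: "real^2"
  assumes "(f has_real_derivative d) (at (z $ 1))"
  shows "partial_deriv i (\<lambda>w. f (w $ 1)) z = (if i = 1 then d else 0)"
proof (cases "i = 1")
  case True
  have "((\<lambda>t. f (z $ 1 + t)) has_real_derivative d) (at 0)"
    using assms DERIV_shift[of f d 0 "z $ 1"] by (simp add: add.commute)
  then show ?thesis
    using True unfolding partial_deriv_def by (simp add: axis_def DERIV_imp_deriv)
next
  case False
  then show ?thesis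
    unfolding partial_deriv_def by (simp add: axis_def)
qed

lemma matrix_inv_mat:
  fixes c :: real
  assumes "c \<noteq> 0"
  shows "matrix_inv (mat c :: real^'n^'n) = mat (1 / c)"
proof -
  have mm: "(mat a :: real^'n^'n) ** mat b = mat (a * b)" for a b :: real
  proof -
    have "(\<Sum>k\<in>UNIV. (if i = k then a else 0) * (if k = j then b else 0))
        = (\<Sum>k\<in>UNIV. if k = i then (if i = j then a * b else 0) else 0)" for i j :: 'n
      by (intro sum.cong refl) auto
    then show ?thesis
      by (simp add: matrix_matrix_mult_def mat_def vec_eq_iff)
  qed
  have "mat c ** matrix_inv (mat c :: real^'n^'n) = mat 1 \<and> matrix_inv (mat c :: real^'n^'n) ** mat c = mat 1"
    unfolding matrix_inv_def
    by (rule someI[of _ "mat (1 / c)"]) (use assms in \<open>simp add: mm\<close>)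
  then have inv: "matrix_inv (mat c :: real^'n^'n) ** mat c = mat 1"
    by blast
  have "matrix_inv (mat c :: real^'n^'n) = matrix_inv (mat c) ** (mat c ** mat (1 / c))"
    using assms by (simp add: mm)
  also have "\<dots> = mat (1 / c)"
    by (simp add: matrix_mul_assoc inv)
  finally show ?thesis .
qed

lemma scalar_curvature_conformal:
  fixes h h' h'' :: "real \<Rightarrow> real"
  assumes pos: "\<And>q. h q > 0"
    and d1: "\<And>q. (h has_real_derivative h' q) (at q)"
    and d2: "\<And>q. (h' has_real_derivative h'' q) (at q)"
  shows "scalar_curvature (\<lambda>z::real^2. mat (h (z $ 1))) z =
           - (1 / h (z $ 1)) * deriv (deriv (\<lambda>q. ln (h q))) (z $ 1)"
proof -
  let ?g = "\<lambda>z::real^2. mat (h (z $ 1)) :: real^2^2"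
  have nz: "h q \<noteq> 0" for q using pos[of q] by simp
  define u where "u = (\<lambda>q. h' q / (2 * h q))"
  define u' where "u' = (\<lambda>q. (h'' q * h q - h' q * h' q) / (2 * h q * h q))"
  have du: "(u has_real_derivative u' q) (at q)" for q
    unfolding u_def u'_def using nz
    by (auto intro!: derivative_eq_intros d1 d2 simp: field_simps)
  have dh: "partial_deriv l (\<lambda>w. ?g w $ i $ j) z = (if i = j \<and> l = 1 then h' (z $ 1) else 0)"
    for l i j z
  proof (cases "i = j")
    case True
    then show ?thesis
      using partial_deriv_fst[OF d1, where z = z and i = l] by (simp add: mat_def)
  next
    case False
    then show ?thesis
      by (simp add: mat_def partial_deriv_def)
  qed
  have inv: "matrix_inv (?g z) $ i $ j = (if i = j then 1 / h (z $ 1) else 0)" for z i j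
    unfolding matrix_inv_mat[OF nz] by (simp add: mat_def)
  define s :: "2 \<Rightarrow> 2 \<Rightarrow> 2 \<Rightarrow> real" where
    "s = (\<lambda>k i j. (if j = k \<and> i = 1 then 1 else 0) + (if i = k \<and> j = 1 then 1 else 0)
                 - (if i = j \<and> k = 1 then 1 else 0))"
  have chr: "christoffel ?g k i j = (\<lambda>z. s k i j * u (z $ 1))" for k i j
  proof
    fix z
    have "k = 1 \<or> k = 2" "i = 1 \<or> i = 2" "j = 1 \<or> j = 2"
      using exhaust_2 by auto
    then show "christoffel ?g k i j z = s k i j * u (z $ 1)"
      unfolding christoffel_def dh inv s_def u_def sum_2 using nz by (auto simp: field_simps)
  qed
  have dchr: "partial_deriv l (christoffel ?g k i j) z = (if l = 1 then s k i j * u' (z $ 1) else 0)"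
    for l k i j z
    unfolding chr by (intro partial_deriv_fst DERIV_cmult du)
  have ric: "ricci ?g j k z = (if j = k then - u' (z $ 1) else 0)" for j k z
  proof -
    have "k = 1 \<or> k = 2" "j = 1 \<or> j = 2"
      using exhaust_2 by auto
    then show ?thesis
      unfolding ricci_def riemann_def dchr sum_2 unfolding chr s_def by auto
  qed
  have "scalar_curvature ?g z = - (1 / h (z $ 1)) * (2 * u' (z $ 1))"
    unfolding scalar_curvature_def ric inv sum_2 by simp
  moreover have "deriv (\<lambda>q. ln (h q)) = (\<lambda>q. 2 * u q)"
  proof
    fix q
    have "((\<lambda>q. ln (h q)) has_real_derivative 2 * u q) (at q)"
      unfolding u_def using pos[of q] by (auto intro!: derivative_eq_intros d1)
    then show "deriv (\<lambda>q. ln (h q)) q = 2 * u q" by (rule DERIV_imp_deriv)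
  qed
  moreover have "deriv (\<lambda>q. 2 * u q) q = 2 * u' q" for q
    by (intro DERIV_imp_deriv DERIV_cmult du)
  ultimately show ?thesis by simp
qed

end

theory Submission
  imports Defs
begin

text \<open>
  Write \<open>y = \<psi>'\<close> for the mean of \<open>F\<close>, so that \<open>h = y'\<close> is the Fisher metric. If the curvature is the
  constant \<open>c\<close>, integrating \<open>(ln h)'' = - c y'\<close> twice gives \<open>y' = Q(y)\<close> for a quadratic polynomial
  \<open>Q\<close> with leading coefficient \<open>- c / 2\<close>. As \<open>\<theta> \<rightarrow> \<plusminus>\<infinity>\<close>, \<open>y\<close> tends to the extreme values \<open>a\<close>, \<open>b\<close> of \<open>F\<close>
  and \<open>y'\<close> to 0, so \<open>y' = (c / 2) (y - a) (b - y)\<close>, whence \<open>(y - a) / (b - y) = K exp (\<beta> \<theta>)\<close>.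
  Cleared of denominators this is an identity between exponential sums in \<open>\<theta>\<close>; comparing
  exponents gives \<open>\<alpha>\<^sub>k = a + k \<beta>\<close>, and comparing coefficients gives the recursion of the binomial
  coefficients for the weights \<open>exp \<omega>\<^sub>k\<close>. Conversely, the binomial family has a logistic mean and
  curvature \<open>2 / p\<close>.
\<close>

section \<open>Exponential sums\<close>

text \<open>Dividing both sums by \<open>exp (t * m)\<close> leaves only the terms at
  \<open>m\<close> in the limit. A general filter \<open>G\<close> covers \<open>at_top\<close> with
  the largest exponent and \<open>at_bot\<close> with the smallest.\<close>

lemma exp_sum_quotient_tendsto:
  fixes f w :: "real \<Rightarrow> real"
  assumes "finite A" "m \<in> A" "w m \<noteq> 0"
    and lim: "\<And>a. a \<in> A \<Longrightarrow> a \<noteq> m \<Longrightarrow> ((\<lambda>t. exp (t * (a - m))) \<longlongrightarrow> 0) G"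
  shows "((\<lambda>t. (\<Sum>a\<in>A. f a * exp (t * a)) / (\<Sum>a\<in>A. w a * exp (t * a))) \<longlongrightarrow> f m / w m) G"
proof -
  have lim_sum: "((\<lambda>t. \<Sum>a\<in>A. g a * exp (t * (a - m))) \<longlongrightarrow> g m) G" for g :: "real \<Rightarrow> real"
  proof -
    have "((\<lambda>t. \<Sum>a\<in>A. g a * exp (t * (a - m))) \<longlongrightarrow> (\<Sum>a\<in>A. if a = m then g a else 0)) G"
    proof (intro tendsto_sum)
      fix a assume "a \<in> A"
      then show "((\<lambda>t. g a * exp (t * (a - m))) \<longlongrightarrow> (if a = m then g a else 0)) G"
        using tendsto_mult_right_zero[OF lim, of a "g a"] by auto
    qed
    then show ?thesis
      using assms by simp
  qed
  have scale: "(\<Sum>a\<in>A. g a * exp (t * a)) = exp (t * m) * (\<Sum>a\<in>A. g a * exp (t * (a - m)))"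
    for g :: "real \<Rightarrow> real" and t
    by (simp add: sum_distrib_left algebra_simps flip: exp_add)
  have "((\<lambda>t. (\<Sum>a\<in>A. f a * exp (t * (a - m))) / (\<Sum>a\<in>A. w a * exp (t * (a - m)))) \<longlongrightarrow> f m / w m) G"
    by (intro tendsto_divide lim_sum assms)
  then show ?thesis
    unfolding scale by simp
qed

lemma exp_mult_tendsto_0_at_top:
  fixes c :: real
  assumes "c < 0"
  shows "((\<lambda>t. exp (t * c)) \<longlongrightarrow> 0) at_top"
  using assms
  by (intro filterlim_compose[OF exp_at_bot] filterlim_ident
      filterlim_tendsto_neg_mult_at_bot[OF tendsto_const, of c "\<lambda>t. t", simplified mult.commute[of c]])

lemma exp_mult_tendsto_0_at_bot:
  fixes c :: real
  assumes "c > 0"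
  shows "((\<lambda>t. exp (t * c)) \<longlongrightarrow> 0) at_bot"
  using exp_mult_tendsto_0_at_top[of "- c"] assms
  by (simp add: at_bot_mirror filterlim_filtermap)

text \<open>Linear independence of exponentials, by splitting off the largest exponent: the quotient
  by the sum with unit coefficients is identically 0 but tends to the leading coefficient.\<close>

lemma exp_sum_eq_0_imp_coeff_eq_0:
  fixes f :: "real \<Rightarrow> real"
  assumes "finite A" "\<And>t. (\<Sum>a\<in>A. f a * exp (t * a)) = 0" "a \<in> A"
  shows "f a = 0"
  using assms
proof (induction A rule: finite_linorder_max_induct)
  case (insert m A)
  have "((\<lambda>t. (\<Sum>a\<in>insert m A. f a * exp (t * a)) / (\<Sum>a\<in>insert m A. (1::real) * exp (t * a)))
          \<longlongrightarrow> f m / 1) at_top"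
    using insert.hyps
    by (intro exp_sum_quotient_tendsto exp_mult_tendsto_0_at_top) auto
  then have fm: "f m = 0"
    unfolding insert.prems(1) by (simp add: tendsto_const_iff)
  moreover have "m \<notin> A"
    using insert.hyps by auto
  ultimately show ?case
    using insert by auto
qed simp

text \<open>Coefficients that vanish off their index sets can be compared over
  \<open>A \<union> B\<close>. There are two index sets because the application shifts the exponents
  on one side.\<close>

lemma exp_sum_coeff_unique:
  fixes f g :: "real \<Rightarrow> real"
  assumes "finite A" "finite B"
    and eq: "\<And>t. (\<Sum>a\<in>A. f a * exp (t * a)) = (\<Sum>b\<in>B. g b * exp (t * b))"
    and "\<And>a. a \<notin> A \<Longrightarrow> f a = 0" "\<And>b. b \<notin> B \<Longrightarrow> g b = 0"
  shows "f = g"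
proof
  fix a
  have "(\<Sum>a\<in>A \<union> B. (f a - g a) * exp (t * a)) = 0" for t
  proof -
    have "(\<Sum>a\<in>A \<union> B. f a * exp (t * a)) = (\<Sum>a\<in>A. f a * exp (t * a))"
      using assms by (intro sum.mono_neutral_right) auto
    moreover have "(\<Sum>a\<in>A \<union> B. g a * exp (t * a)) = (\<Sum>b\<in>B. g b * exp (t * b))"
      using assms by (intro sum.mono_neutral_right) auto
    ultimately show ?thesis
      using eq[of t] by (simp add: left_diff_distrib sum_subtractf)
  qed
  then have "a \<in> A \<union> B \<Longrightarrow> f a - g a = 0"
    using assms exp_sum_eq_0_imp_coeff_eq_0[of "A \<union> B" "\<lambda>a. f a - g a"] by simp
  then show "f a = g a"
    using assms(4,5)[of a] by (cases "a \<in> A \<union> B") auto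
qed

section \<open>Moments and the Fisher metric\<close>

lemma DERIV_eq_0_imp_const:
  fixes f :: "real \<Rightarrow> real"
  assumes "\<And>t. (f has_real_derivative 0) (at t)"
  shows "f t = f 0"
  using DERIV_const_ratio_const[of t 0 f 0] DERIV_isconst_all[of f t 0] assms by blast

definition ef_partition :: "'a exp_family \<Rightarrow> real \<Rightarrow> real" where
  "ef_partition E \<theta> = (\<Sum>x\<in>ef_space E. exp (ef_C E x + \<theta> * ef_F E x))"

definition ef_moment :: "'a exp_family \<Rightarrow> nat \<Rightarrow> real \<Rightarrow> real" where
  "ef_moment E n \<theta> = (\<Sum>x\<in>ef_space E. ef_F E x ^ n * ef_prob E \<theta> x)"

text \<open>These are the numbers \<open>exp (ef_omega E k)\<close>, indexed by the value of
  \<open>F\<close> instead of its rank. Since they are 0 off the values of \<open>F\<close>, a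
  recursion for them can be stated at every real.\<close>

definition ef_weight :: "'a exp_family \<Rightarrow> real \<Rightarrow> real" where
  "ef_weight E a = (\<Sum>x\<in>{x\<in>ef_space E. ef_F E x = a}. exp (ef_C E x))"

locale exp_fam =
  fixes E :: "'a exp_family"
  assumes fam: "is_exp_family E"
begin

abbreviation "\<Omega> \<equiv> ef_space E"
abbreviation "F \<equiv> ef_F E"
abbreviation "p \<equiv> ef_prob E"
abbreviation "\<mu> \<equiv> ef_moment E"
abbreviation "Z \<equiv> ef_partition E"
abbreviation "h \<equiv> fisher_metric E"
abbreviation "w \<equiv> ef_weight E"
abbreviation "lo \<equiv> Min (F ` \<Omega>)"
abbreviation "hi \<equiv> Max (F ` \<Omega>)"

lemma finite_space: "finite \<Omega>"
  using fam by (simp add: is_exp_family_def)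

lemma space_nonempty: "\<Omega> \<noteq> {}"
  using fam by (auto simp: is_exp_family_def constant_on_def)

lemma ex_F_neq: "\<exists>x\<in>\<Omega>. F x \<noteq> c"
  using fam by (auto simp: is_exp_family_def constant_on_def)

lemma Z_pos: "Z \<theta> > 0"
  unfolding ef_partition_def using finite_space space_nonempty by (intro sum_pos) auto

lemma psi_eq: "ef_psi E \<theta> = ln (Z \<theta>)"
  by (simp add: ef_psi_def ef_partition_def)

lemma prob_eq: "p \<theta> x = exp (ef_C E x + \<theta> * F x) / Z \<theta>"
  using Z_pos[of \<theta>] by (simp add: ef_prob_def psi_eq exp_diff)

lemma prob_pos: "p \<theta> x > 0"
  by (simp add: ef_prob_def)

lemma sum_prob: "(\<Sum>x\<in>\<Omega>. p \<theta> x) = 1"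
  unfolding prob_eq sum_divide_distrib[symmetric] using Z_pos[of \<theta>] by (simp add: ef_partition_def)

text \<open>The non-constant \<open>F\<close> takes a value other than the only possible zero
  \<open>c\<close> of \<open>g\<close>. This serves the variance and both bounds on the
  mean.\<close>

lemma sum_prob_pos:
  assumes "\<And>x. x \<in> \<Omega> \<Longrightarrow> g (F x) \<ge> 0" "\<And>a. g a = 0 \<Longrightarrow> a = c"
  shows "(\<Sum>x\<in>\<Omega>. g (F x) * p \<theta> x) > 0"
proof -
  obtain x where x: "x \<in> \<Omega>" "F x \<noteq> c"
    using ex_F_neq by blast
  show ?thesis
  proof (rule sum_pos2[OF finite_space x(1)])
    show "g (F x) * p \<theta> x > 0"
      using x assms prob_pos by (metis less_le mult_pos_pos)
  qed (use assms prob_pos in \<open>auto intro!: mult_nonneg_nonneg less_imp_le[OF prob_pos]\<close>)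
qed

section \<open>Derivatives of the log-partition function, the densities and the moments\<close>

lemma DERIV_psi: "(ef_psi E has_real_derivative \<mu> 1 \<theta>) (at \<theta>)"
proof -
  have "(Z has_real_derivative (\<Sum>x\<in>\<Omega>. exp (ef_C E x + \<theta> * F x) * F x)) (at \<theta>)"
    unfolding ef_partition_def by (auto intro!: derivative_eq_intros)
  then have "((\<lambda>\<theta>. ln (Z \<theta>)) has_real_derivative
      (\<Sum>x\<in>\<Omega>. exp (ef_C E x + \<theta> * F x) * F x) / Z \<theta>) (at \<theta>)"
    using Z_pos[of \<theta>] by (auto intro!: derivative_eq_intros)
  then show ?thesis
    unfolding psi_eq[abs_def] ef_moment_def prob_eq
    by (simp add: sum_divide_distrib mult.commute)
qed

lemma DERIV_prob: "((\<lambda>\<theta>. p \<theta> x) has_real_derivative p \<theta> x * (F x - \<mu> 1 \<theta>)) (at \<theta>)"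
  unfolding ef_prob_def by (auto intro!: derivative_eq_intros DERIV_psi)

text \<open>The derivative is the covariance of \<open>F ^ n\<close> and \<open>F\<close>.\<close>

lemma DERIV_moment: "(\<mu> n has_real_derivative \<mu> (Suc n) \<theta> - \<mu> n \<theta> * \<mu> 1 \<theta>) (at \<theta>)"
proof -
  have "(\<mu> n has_real_derivative (\<Sum>x\<in>\<Omega>. F x ^ n * (p \<theta> x * (F x - \<mu> 1 \<theta>)))) (at \<theta>)"
    unfolding ef_moment_def[of E n, abs_def] by (intro DERIV_sum DERIV_cmult DERIV_prob)
  also have "(\<Sum>x\<in>\<Omega>. F x ^ n * (p \<theta> x * (F x - \<mu> 1 \<theta>))) = \<mu> (Suc n) \<theta> - \<mu> n \<theta> * \<mu> 1 \<theta>"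
    unfolding ef_moment_def[of E n] ef_moment_def[of E "Suc n"]
    by (simp add: sum_distrib_left right_diff_distrib sum_subtractf ac_simps)
  finally show ?thesis .
qed

lemma fisher_eq_sum: "h \<theta> = (\<Sum>x\<in>\<Omega>. (F x - \<mu> 1 \<theta>)\<^sup>2 * p \<theta> x)"
proof -
  \<comment> \<open>The score is the deviation of \<open>F\<close> from its mean, so the Fisher
    metric is the variance of \<open>F\<close>.\<close>
  have "deriv (\<lambda>t. ln (p t x)) \<theta> = F x - \<mu> 1 \<theta>" for x
    unfolding ef_prob_def ln_exp
    by (rule DERIV_imp_deriv) (auto intro!: derivative_eq_intros DERIV_psi)
  then show ?thesis
    by (simp add: fisher_metric_def)
qed

lemma fisher_eq: "h \<theta> = \<mu> 2 \<theta> - (\<mu> 1 \<theta>)\<^sup>2"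
proof -
  have "h \<theta> = (\<Sum>x\<in>\<Omega>. F x ^ 2 * p \<theta> x - 2 * \<mu> 1 \<theta> * (F x ^ 1 * p \<theta> x) + (\<mu> 1 \<theta>)\<^sup>2 * p \<theta> x)"
    unfolding fisher_eq_sum by (intro sum.cong refl) (simp add: power2_eq_square algebra_simps)
  also have "\<dots> = \<mu> 2 \<theta> - 2 * \<mu> 1 \<theta> * \<mu> 1 \<theta> + (\<mu> 1 \<theta>)\<^sup>2 * 1"
    unfolding sum.distrib sum_subtractf sum_distrib_left[symmetric] sum_prob
    by (simp add: ef_moment_def)
  finally show ?thesis
    by (simp add: power2_eq_square)
qed

lemma fisher_pos: "h \<theta> > 0"
  unfolding fisher_eq_sum
  by (rule sum_prob_pos[where g = "\<lambda>a. (a - \<mu> 1 \<theta>)\<^sup>2" and c = "\<mu> 1 \<theta>"]) auto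

lemma DERIV_mean: "(\<mu> 1 has_real_derivative h \<theta>) (at \<theta>)"
  using DERIV_moment[of 1 \<theta>] by (simp add: fisher_eq power2_eq_square numeral_2_eq_2)

text \<open>The variance is a polynomial in the moments, and the moment recursion differentiates it
  twice.\<close>

lemma fisher_twice_differentiable:
  "\<exists>h' h''. (\<forall>\<theta>. (h has_real_derivative h' \<theta>) (at \<theta>)) \<and> (\<forall>\<theta>. (h' has_real_derivative h'' \<theta>) (at \<theta>))"
proof (intro exI conjI allI)
  fix \<theta>
  let ?h' = "\<lambda>\<theta>. \<mu> 3 \<theta> - \<mu> 2 \<theta> * \<mu> 1 \<theta> - 2 * \<mu> 1 \<theta> * h \<theta>"
  show h': "(h has_real_derivative ?h' \<theta>) (at \<theta>)" for \<theta>
    unfolding fisher_eq[abs_def] using DERIV_mean[of \<theta>] DERIV_moment[of 2 \<theta>]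
    by (auto intro!: derivative_eq_intros simp: numeral_eq_Suc fisher_eq)
  show "(?h' has_real_derivative
          (\<mu> 4 \<theta> - \<mu> 3 \<theta> * \<mu> 1 \<theta>) - ((\<mu> 3 \<theta> - \<mu> 2 \<theta> * \<mu> 1 \<theta>) * \<mu> 1 \<theta> + \<mu> 2 \<theta> * h \<theta>)
          - 2 * (h \<theta> * h \<theta> + \<mu> 1 \<theta> * ?h' \<theta>)) (at \<theta>)"
    using DERIV_mean[of \<theta>] DERIV_moment[of 2 \<theta>] DERIV_moment[of 3 \<theta>] h'[of \<theta>]
    by (auto intro!: derivative_eq_intros simp: eval_nat_numeral algebra_simps)
qed

section \<open>The curvature of the tangent bundle in terms of the Fisher metric\<close>

lemma scalar_curvature_tangent_bundle:
  "scalar_curvature (tangent_bundle_metric E) z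
     = - (1 / h (z $ 1)) * deriv (deriv (\<lambda>q. ln (h q))) (z $ 1)"
  using scalar_curvature_conformal[of h _ _ z] fisher_pos fisher_twice_differentiable
  unfolding tangent_bundle_metric_def by blast

lemma constant_curvature_iff:
  "(\<forall>z. scalar_curvature (tangent_bundle_metric E) z = c)
     \<longleftrightarrow> (\<forall>\<theta>. deriv (deriv (\<lambda>q. ln (h q))) \<theta> = - c * h \<theta>)"
proof -
  have "(- (1 / h \<theta>) * d = c) \<longleftrightarrow> d = - c * h \<theta>" for d \<theta>
    using fisher_pos[of \<theta>] by (auto simp: field_simps)
  \<comment> \<open>Every real is the first coordinate of some vector, and the curvature depends on
    that coordinate alone.\<close>
  moreover have "(\<forall>z::real^2. P (z $ 1)) \<longleftrightarrow> (\<forall>\<theta>. P \<theta>)" for P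
    by (metis vec_component)
  ultimately show ?thesis
    unfolding scalar_curvature_tangent_bundle by simp
qed

subsection \<open>Grouping by the values of \<open>F\<close>\<close>

text \<open>Summing over the fibres of \<open>F\<close> first makes the exponents distinct, as
  needed for limits and for comparing coefficients.\<close>

lemma sum_space_eq_sum_values:
  "(\<Sum>x\<in>\<Omega>. g (F x) * exp (ef_C E x + \<theta> * F x)) = (\<Sum>a\<in>F ` \<Omega>. g a * w a * exp (\<theta> * a))"
  unfolding sum.image_gen[OF finite_space, of _ F] ef_weight_def
  by (intro sum.cong refl) (auto simp: sum_distrib_left sum_distrib_right exp_add intro!: sum.cong)

lemma weight_pos: "a \<in> F ` \<Omega> \<Longrightarrow> w a > 0"
  unfolding ef_weight_def using finite_space by (intro sum_pos) auto

lemma weight_eq_0: "a \<notin> F ` \<Omega> \<Longrightarrow> w a = 0"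
  unfolding ef_weight_def by (intro sum.neutral) auto

lemma moment_quotient:
  "\<mu> n \<theta> = (\<Sum>a\<in>F ` \<Omega>. a ^ n * w a * exp (\<theta> * a)) / (\<Sum>a\<in>F ` \<Omega>. w a * exp (\<theta> * a))"
  using sum_space_eq_sum_values[of "\<lambda>a. a ^ n" \<theta>] sum_space_eq_sum_values[of "\<lambda>a. 1" \<theta>]
  unfolding ef_moment_def prob_eq ef_partition_def by (simp flip: sum_divide_distrib)

lemma moment_tendsto:
  assumes "m \<in> F ` \<Omega>"
    and "\<And>a. a \<in> F ` \<Omega> \<Longrightarrow> a \<noteq> m \<Longrightarrow> ((\<lambda>t. exp (t * (a - m))) \<longlongrightarrow> 0) G"
  shows "(\<mu> n \<longlongrightarrow> m ^ n) G"
proof -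
  have "w m \<noteq> 0"
    using weight_pos[OF assms(1)] by simp
  then show ?thesis
    using exp_sum_quotient_tendsto[of "F ` \<Omega>" m w G "\<lambda>a. a ^ n * w a"] assms finite_space
    unfolding moment_quotient[abs_def] by simp
qed

section \<open>Limits at infinity and bounds for the mean\<close>

lemma lo_in: "lo \<in> F ` \<Omega>" and hi_in: "hi \<in> F ` \<Omega>"
  using finite_space space_nonempty by simp_all

lemma moment_at_bot: "(\<mu> n \<longlongrightarrow> lo ^ n) at_bot"
  using finite_space by (intro moment_tendsto lo_in exp_mult_tendsto_0_at_bot) (simp add: less_le)

lemma moment_at_top: "(\<mu> n \<longlongrightarrow> hi ^ n) at_top"
  using finite_space by (intro moment_tendsto hi_in exp_mult_tendsto_0_at_top) (simp add: less_le)

text \<open>In the limit the first two moments are those of a point mass at \<open>m\<close>, whose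
  variance is 0.\<close>

lemma fisher_tendsto_0:
  assumes "\<And>n. (\<mu> n \<longlongrightarrow> m ^ n) G"
  shows "(h \<longlongrightarrow> 0) G"
proof -
  have "((\<lambda>\<theta>. \<mu> 2 \<theta> - (\<mu> 1 \<theta>)\<^sup>2) \<longlongrightarrow> m ^ 2 - (m ^ 1)\<^sup>2) G"
    by (intro tendsto_intros assms)
  then show ?thesis
    by (simp add: fisher_eq[abs_def])
qed

lemma mean_minus_lo: "\<mu> 1 \<theta> - lo = (\<Sum>x\<in>\<Omega>. (F x - lo) * p \<theta> x)"
  and hi_minus_mean: "hi - \<mu> 1 \<theta> = (\<Sum>x\<in>\<Omega>. (hi - F x) * p \<theta> x)"
  by (simp_all add: left_diff_distrib sum_subtractf ef_moment_def sum_prob flip: sum_distrib_left)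

lemma lo_less_mean: "lo < \<mu> 1 \<theta>"
proof -
  have "(\<Sum>x\<in>\<Omega>. (F x - lo) * p \<theta> x) > 0"
    using finite_space by (intro sum_prob_pos[where g = "\<lambda>a. a - lo" and c = lo]) auto
  then show ?thesis
    unfolding mean_minus_lo[symmetric] by simp
qed

lemma mean_less_hi: "\<mu> 1 \<theta> < hi"
proof -
  have "(\<Sum>x\<in>\<Omega>. (hi - F x) * p \<theta> x) > 0"
    using finite_space by (intro sum_prob_pos[where g = "\<lambda>a. hi - a" and c = hi]) auto
  then show ?thesis
    unfolding hi_minus_mean[symmetric] by simp
qed

section \<open>Constant curvature forces a binomial family\<close>

lemma fisher_eq_logistic:
  assumes "\<And>\<theta>. deriv (deriv (\<lambda>q. ln (h q))) \<theta> = - c * h \<theta>"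
  shows "h \<theta> = c / 2 * (\<mu> 1 \<theta> - lo) * (hi - \<mu> 1 \<theta>)"
proof -
  obtain h' h'' where h': "\<And>\<theta>. (h has_real_derivative h' \<theta>) (at \<theta>)"
    and h'': "\<And>\<theta>. (h' has_real_derivative h'' \<theta>) (at \<theta>)"
    using fisher_twice_differentiable by blast
  have nz: "h \<theta> \<noteq> 0" for \<theta>
    using fisher_pos[of \<theta>] by simp
  have dln: "deriv (\<lambda>q. ln (h q)) = (\<lambda>q. h' q / h q)"
    using fisher_pos by (auto intro!: DERIV_imp_deriv derivative_eq_intros h' simp: fun_eq_iff)
  have "((\<lambda>q. h' q / h q) has_real_derivative - c * h \<theta>) (at \<theta>)" for \<theta>
  proof -
    \<comment> \<open>An equation for \<open>deriv\<close> does not by itself give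
      differentiability, which is therefore supplied first.\<close>
    have "(\<lambda>q. h' q / h q) differentiable (at \<theta>)"
      using DERIV_divide[OF h'' h' nz] real_differentiable_def by blast
    then show ?thesis
      using assms[of \<theta>] unfolding dln by (metis DERIV_deriv_iff_real_differentiable)
  qed
  then have "((\<lambda>q. h' q / h q + c * \<mu> 1 q) has_real_derivative - c * h \<theta> + c * h \<theta>) (at \<theta>)" for \<theta>
    by (intro DERIV_add DERIV_cmult DERIV_mean)
  then have zero: "((\<lambda>q. h' q / h q + c * \<mu> 1 q) has_real_derivative 0) (at \<theta>)" for \<theta>
    by simp
  \<comment> \<open>The constant of the first integration.\<close>
  define a where "a = h' 0 / h 0 + c * \<mu> 1 0"
  have "h' \<theta> / h \<theta> + c * \<mu> 1 \<theta> = a" for \<theta>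
    unfolding a_def by (rule DERIV_eq_0_imp_const[OF zero])
  then have "h' \<theta> / h \<theta> = a - c * \<mu> 1 \<theta>" for \<theta>
    by (simp add: eq_diff_eq)
  then have h'_eq: "h' \<theta> = (a - c * \<mu> 1 \<theta>) * h \<theta>" for \<theta>
    using nz[of \<theta>] by (simp only: divide_eq_eq simp_thms)
  \<comment> \<open>By the equation for \<open>h'\<close>, the Fisher metric differs from a
    quadratic in the mean only by a constant, the second constant of integration
    \<open>b\<close>.\<close>
  have zero': "((\<lambda>q. h q - a * \<mu> 1 q + c / 2 * (\<mu> 1 q)\<^sup>2) has_real_derivative 0) (at \<theta>)" for \<theta>
    by (rule derivative_eq_intros h' DERIV_mean refl)+ (simp add: h'_eq algebra_simps)
  define b where "b = h 0 - a * \<mu> 1 0 + c / 2 * (\<mu> 1 0)\<^sup>2"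
  have b: "h \<theta> - a * \<mu> 1 \<theta> + c / 2 * (\<mu> 1 \<theta>)\<^sup>2 = b" for \<theta>
    unfolding b_def by (rule DERIV_eq_0_imp_const[OF zero'])
  \<comment> \<open>As \<open>h\<close> tends to 0, the limit \<open>m\<close> of the mean becomes a
    root of the quadratic \<open>b + a * m - c / 2 * m\<^sup>2\<close>.\<close>
  have root: "0 - a * m + c / 2 * m\<^sup>2 = b" if "\<And>n. (\<mu> n \<longlongrightarrow> m ^ n) G" "G \<noteq> bot" for m G
  proof -
    have "((\<lambda>\<theta>. h \<theta> - a * \<mu> 1 \<theta> + c / 2 * (\<mu> 1 \<theta>)\<^sup>2) \<longlongrightarrow> 0 - a * (m ^ 1) + c / 2 * (m ^ 1)\<^sup>2) G"
      by (intro tendsto_intros fisher_tendsto_0[OF that(1)] that(1))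
    then show ?thesis
      unfolding b using that(2) by (simp add: tendsto_const_iff)
  qed
  have lo: "0 - a * lo + c / 2 * lo\<^sup>2 = b"
    by (rule root[OF moment_at_bot]) simp
  have hi: "0 - a * hi + c / 2 * hi\<^sup>2 = b"
    by (rule root[OF moment_at_top]) simp
  \<comment> \<open>The difference of the two root equations determines \<open>a\<close>, because
    \<open>lo < hi\<close>.\<close>
  have "(hi - lo) * (c / 2 * (hi + lo) - a) = 0"
    using lo hi by (simp add: field_simps power2_eq_square)
  then have a: "a = c / 2 * (hi + lo)"
    using lo_less_mean[of 0] mean_less_hi[of 0] by auto
  show ?thesis
    using b[of \<theta>] lo unfolding a by (simp add: field_simps power2_eq_square)
qed

text \<open>By the logistic equation the odds
  \<open>(\<mu> 1 \<theta> - lo) / (hi - \<mu> 1 \<theta>)\<close> grow at the constant relative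
  rate \<open>\<beta>\<close>. Hence \<open>R\<close> is constant, and \<open>K\<close> is its value
  at 0.\<close>

lemma mean_odds_exponential:
  assumes "\<And>\<theta>. h \<theta> = c / 2 * (\<mu> 1 \<theta> - lo) * (hi - \<mu> 1 \<theta>)"
  obtains \<beta> K where "\<beta> > 0" "K > 0"
    "\<And>\<theta>. \<mu> 1 \<theta> - lo = K * exp (\<theta> * \<beta>) * (hi - \<mu> 1 \<theta>)"
proof -
  define \<beta> where "\<beta> = c / 2 * (hi - lo)"
  define R where "R = (\<lambda>\<theta>. (\<mu> 1 \<theta> - lo) / (hi - \<mu> 1 \<theta>) * exp (- \<theta> * \<beta>))"
  have lt: "lo < \<mu> 1 \<theta>" "\<mu> 1 \<theta> < hi" for \<theta>
    by (fact lo_less_mean mean_less_hi)+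
  \<comment> \<open>Positivity of the Fisher metric forces \<open>c > 0\<close>, hence
    \<open>\<beta> > 0\<close>.\<close>
  have "c / 2 * ((\<mu> 1 0 - lo) * (hi - \<mu> 1 0)) > 0"
    using fisher_pos[of 0] unfolding assms[of 0] by (simp add: mult.assoc)
  moreover have "(\<mu> 1 0 - lo) * (hi - \<mu> 1 0) > 0"
    using lt[of 0] by simp
  ultimately have "c > 0"
    using zero_less_mult_pos2 by fastforce
  then have "\<beta> > 0"
    using lt[of 0] by (simp add: \<beta>_def)
  moreover have "(R has_real_derivative 0) (at \<theta>)" for \<theta>
  proof -
    let ?x = "\<mu> 1 \<theta> - lo" and ?y = "hi - \<mu> 1 \<theta>"
    have nz: "?y \<noteq> 0"
      using lt[of \<theta>] by simp
    have "((\<lambda>\<theta>. (\<mu> 1 \<theta> - lo) / (hi - \<mu> 1 \<theta>)) has_real_derivative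
        (h \<theta> * ?y - ?x * (0 - h \<theta>)) / (?y * ?y)) (at \<theta>)"
      using DERIV_divide[OF DERIV_diff[OF DERIV_mean DERIV_const]
          DERIV_diff[OF DERIV_const DERIV_mean] nz] by simp
    also have "h \<theta> * ?y - ?x * (0 - h \<theta>) = h \<theta> * (hi - lo)"
      by (simp add: algebra_simps)
    also have "\<dots> = \<beta> * ?x * ?y"
      unfolding \<beta>_def assms[of \<theta>] by (simp only: mult_ac)
    also have "\<beta> * ?x * ?y / (?y * ?y) = \<beta> * (?x / ?y)"
      using nz by simp
    finally have "((\<lambda>\<theta>. (\<mu> 1 \<theta> - lo) / (hi - \<mu> 1 \<theta>)) has_real_derivative \<beta> * (?x / ?y)) (at \<theta>)" .
    moreover have "((\<lambda>\<theta>. exp (- \<theta> * \<beta>)) has_real_derivative - \<beta> * exp (- \<theta> * \<beta>)) (at \<theta>)"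
      by (auto intro!: derivative_eq_intros)
    ultimately show ?thesis
      unfolding R_def using DERIV_mult by fastforce
  qed
  then have R: "R \<theta> = R 0" for \<theta>
    by (rule DERIV_eq_0_imp_const)
  have "\<mu> 1 \<theta> - lo = R 0 * exp (\<theta> * \<beta>) * (hi - \<mu> 1 \<theta>)" for \<theta>
    using lt[of \<theta>] unfolding R[of \<theta>, symmetric] unfolding R_def by (simp add: exp_minus)
  moreover have "R 0 > 0"
    unfolding R_def using lt[of 0] by simp
  ultimately show ?thesis
    using that by blast
qed

text \<open>Multiplied by \<open>Z\<close>, the odds identity equates two exponential sums, where
  the factor \<open>exp (\<theta> * \<beta>)\<close> shifts the exponents on the right by
  \<open>\<beta>\<close>. The recursion compares the coefficients at
  \<open>b + \<beta>\<close>.\<close>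

lemma weight_recursion:
  assumes "\<And>\<theta>. \<mu> 1 \<theta> - lo = K * exp (\<theta> * \<beta>) * (hi - \<mu> 1 \<theta>)"
  shows "(b + \<beta> - lo) * w (b + \<beta>) = K * (hi - b) * w b"
proof -
  let ?A = "F ` \<Omega>"
  have num: "(\<Sum>x\<in>\<Omega>. g (F x) * p \<theta> x) * Z \<theta> = (\<Sum>a\<in>?A. g a * w a * exp (\<theta> * a))" for g \<theta>
    using Z_pos[of \<theta>] unfolding sum_space_eq_sum_values[symmetric] prob_eq
    by (simp add: sum_distrib_right)
  have "(\<Sum>a\<in>?A. ((a - lo) * w a) * exp (\<theta> * a))
      = (\<Sum>b\<in>(\<lambda>a. a + \<beta>) ` ?A. (K * (hi - (b - \<beta>)) * w (b - \<beta>)) * exp (\<theta> * b))" for \<theta>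
  proof -
    have "(\<Sum>a\<in>?A. ((a - lo) * w a) * exp (\<theta> * a)) = (\<mu> 1 \<theta> - lo) * Z \<theta>"
      unfolding mean_minus_lo by (rule num[of "\<lambda>a. a - lo", symmetric])
    also have "\<dots> = K * exp (\<theta> * \<beta>) * ((hi - \<mu> 1 \<theta>) * Z \<theta>)"
      by (simp only: assms mult.assoc)
    also have "\<dots> = K * exp (\<theta> * \<beta>) * (\<Sum>a\<in>?A. (hi - a) * w a * exp (\<theta> * a))"
      unfolding hi_minus_mean by (simp only: num[of "\<lambda>a. hi - a"])
    also have "\<dots> = (\<Sum>b\<in>(\<lambda>a. a + \<beta>) ` ?A. (K * (hi - (b - \<beta>)) * w (b - \<beta>)) * exp (\<theta> * b))"
      by (subst sum.reindex) (auto simp: sum_distrib_left distrib_left exp_add ac_simps inj_on_def)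
    finally show ?thesis .
  qed
  then have "(\<lambda>a. (a - lo) * w a) = (\<lambda>b. K * (hi - (b - \<beta>)) * w (b - \<beta>))"
  proof (rule exp_sum_coeff_unique[rotated 2])
    fix b assume "b \<notin> (\<lambda>a. a + \<beta>) ` ?A"
    then have "b - \<beta> \<notin> ?A"
      by (metis diff_add_cancel image_eqI)
    then show "K * (hi - (b - \<beta>)) * w (b - \<beta>) = 0"
      by (simp add: weight_eq_0)
  qed (use finite_space in \<open>simp_all add: weight_eq_0\<close>)
  from fun_cong[OF this, of "b + \<beta>"] show ?thesis
    by simp
qed


text \<open>Descent: for a value \<open>a\<close> other than \<open>lo\<close>, the recursion at
  \<open>a - \<beta>\<close> has a nonzero left side, so \<open>a - \<beta>\<close> is a value
  too.\<close>

lemma values_in_arith_progression: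
  assumes "\<beta> > 0"
    and rec: "\<And>b. (b + \<beta> - lo) * w (b + \<beta>) = K * (hi - b) * w b"
    and "a \<in> F ` \<Omega>"
  shows "\<exists>j::nat. a = lo + real j * \<beta>"
proof -
  \<comment> \<open>The Archimedean bound \<open>n\<close> limits the length of the descent; for
    \<open>n = 0\<close> the value would lie below the minimum \<open>lo\<close>.\<close>
  obtain n where "a - lo < real n * \<beta>"
    using ex_less_of_nat_mult assms(1) by blast
  then show ?thesis
    using \<open>a \<in> F ` \<Omega>\<close>
  proof (induction n arbitrary: a)
    case 0
    then have "lo \<le> a"
      using finite_space by simp
    then show ?case
      using 0 by simp
  next
    case (Suc n)
    show ?case
    proof (cases "a = lo")
      case True
      then show ?thesis
        by (intro exI[of _ 0]) simp
    next
      case False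
      then have "w (a - \<beta>) \<noteq> 0"
        using rec[of "a - \<beta>"] weight_pos[OF Suc.prems(2)] by auto
      then have "a - \<beta> \<in> F ` \<Omega>"
        using weight_eq_0 by blast
      then obtain j :: nat where "a - \<beta> = lo + real j * \<beta>"
        using Suc.IH[of "a - \<beta>"] Suc.prems(1) by (auto simp: algebra_simps)
      then show ?thesis
        by (intro exI[of _ "Suc j"]) (simp add: algebra_simps)
    qed
  qed
qed

text \<open>The values leave no gap in the progression: \<open>ef_alpha E k + \<beta>\<close> is a
  value and bounds the next one from above, while membership in the progression bounds it from
  below.\<close>

lemma ef_alpha_eq_arith_progression:
  assumes "\<beta> > 0" "K > 0"
    and rec: "\<And>b. (b + \<beta> - lo) * w (b + \<beta>) = K * (hi - b) * w b"
    and "k < card (F ` \<Omega>)"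
  shows "ef_alpha E k = lo + real k * \<beta>"
  using \<open>k < card (F ` \<Omega>)\<close>
proof (induction k)
  case 0
  obtain j where j: "j < card (F ` \<Omega>)" "ef_alpha E j = lo"
    using lo_in ef_alpha_image[OF finite_space] by (metis (no_types, lifting) imageE lessThan_iff)
  have "ef_alpha E 0 \<in> F ` \<Omega>"
    using 0 ef_alpha_image[OF finite_space] by blast
  then have "lo \<le> ef_alpha E 0"
    using finite_space by simp
  moreover have "ef_alpha E 0 \<le> ef_alpha E j"
    using 0 j strict_mono_on_leD[OF ef_alpha_strict_mono[OF finite_space], of 0 j] by simp
  ultimately show ?case
    using j by simp
next
  case (Suc k)
  let ?\<alpha> = "ef_alpha E"
  have in_image: "?\<alpha> i \<in> F ` \<Omega>" if "i < card (F ` \<Omega>)" for i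
    using that ef_alpha_image[OF finite_space] by blast
  have less_iff: "?\<alpha> i < ?\<alpha> j \<longleftrightarrow> i < j" if "i < card (F ` \<Omega>)" "j < card (F ` \<Omega>)" for i j
    using that strict_mono_on_less[OF ef_alpha_strict_mono[OF finite_space]] by simp
  have ex_index: "\<exists>i<card (F ` \<Omega>). ?\<alpha> i = a" if "a \<in> F ` \<Omega>" for a
    using that ef_alpha_image[OF finite_space] by (metis (no_types, lifting) imageE lessThan_iff)
  have lt: "?\<alpha> k < ?\<alpha> (Suc k)" "lo \<le> ?\<alpha> k" "?\<alpha> (Suc k) \<le> hi"
    using Suc.prems less_iff in_image finite_space by simp_all
  \<comment> \<open>Since \<open>k\<close> is not the last index, \<open>?\<alpha> k < hi\<close>
    and the right side of the recursion is positive.\<close>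
  have "w (?\<alpha> k + \<beta>) \<noteq> 0"
    using rec[of "?\<alpha> k"] weight_pos[OF in_image[of k]] lt Suc.prems assms(1,2) by auto
  then obtain i where i: "i < card (F ` \<Omega>)" "?\<alpha> i = ?\<alpha> k + \<beta>"
    using weight_eq_0 ex_index by blast
  have "\<not> i < Suc k"
    using less_iff[of k i] i assms(1) Suc.prems by auto
  then have "?\<alpha> (Suc k) \<le> ?\<alpha> k + \<beta>"
    using less_iff[of i "Suc k"] i Suc.prems by (simp add: not_less)
  moreover obtain j :: nat where j: "?\<alpha> (Suc k) = lo + real j * \<beta>"
    using values_in_arith_progression[OF assms(1) rec in_image] Suc.prems by blast
  \<comment> \<open>Both values lie in the progression, so the strict inequality between them gives
    \<open>k < j\<close> and thus \<open>Suc k \<le> j\<close>.\<close>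
  then have "real k * \<beta> < real j * \<beta>"
    using lt Suc by simp
  then have "real (Suc k) * \<beta> \<le> real j * \<beta>"
    using assms(1) by (intro mult_right_mono) auto
  ultimately show ?case
    using Suc j by (simp add: algebra_simps)
qed

text \<open>Successive weights have the ratio \<open>K * (n - k) / (k + 1)\<close>, the same as for
  \<open>K ^ k * (n choose k)\<close> by absorption.\<close>

lemma weight_eq_binomial:
  assumes "\<beta> > 0"
    and rec: "\<And>b. (b + \<beta> - lo) * w (b + \<beta>) = K * (hi - b) * w b"
    and hi: "hi = lo + real n * \<beta>"
    and "k \<le> n"
  shows "w (lo + real k * \<beta>) = w lo * K ^ k * real (n choose k)"
  using \<open>k \<le> n\<close>
proof (induction k)
  case (Suc k)
  have "\<beta> * (real (Suc k) * w (lo + real (Suc k) * \<beta>)) = \<beta> * (K * real (n - k) * w (lo + real k * \<beta>))"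
    using rec[of "lo + real k * \<beta>"] Suc.prems unfolding hi
    by (simp add: of_nat_diff algebra_simps)
  then have "real (Suc k) * w (lo + real (Suc k) * \<beta>) = K * real (n - k) * w (lo + real k * \<beta>)"
    using assms(1) by simp
  also have "\<dots> = w lo * K ^ Suc k * real ((n - k) * (n choose k))"
    using Suc by simp
  also have "(n - k) * (n choose k) = Suc k * (n choose Suc k)"
    using binomial_absorb_comp[of n k] Suc_times_binomial_eq[of "n - 1" k] Suc.prems
    by (metis binomial_absorption)
  finally have "real (Suc k) * w (lo + real (Suc k) * \<beta>)
      = real (Suc k) * (w lo * K ^ Suc k * real (n choose Suc k))"
    by (simp only: of_nat_mult ac_simps)
  then show ?case
    by (simp only: mult_cancel_left) simp
qed simp

text \<open>Each \<open>exp (ef_omega E k)\<close> collects a whole fibre of \<open>F\<close>. The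
  common partition function lets a formula for \<open>ef_psi\<close> pass from the reduced family to
  \<open>E\<close>.\<close>

lemma partition_reduced: "ef_partition (reduced_family E) \<theta> = Z \<theta>"
proof -
  let ?I = "{..<card (F ` \<Omega>)}"
  have "ef_partition (reduced_family E) \<theta> = (\<Sum>k\<in>?I. w (ef_alpha E k) * exp (\<theta> * ef_alpha E k))"
    unfolding ef_partition_def reduced_family_def ef_weight_def
    by (simp add: exp_add exp_ef_omega[OF finite_space])
  also have "\<dots> = (\<Sum>a\<in>ef_alpha E ` ?I. w a * exp (\<theta> * a))"
    using strict_mono_on_imp_inj_on[OF ef_alpha_strict_mono[OF finite_space]]
    by (subst sum.reindex) auto
  also have "\<dots> = Z \<theta>"
    unfolding ef_alpha_image[OF finite_space] ef_partition_def
    using sum_space_eq_sum_values[of "\<lambda>a. 1" \<theta>] by simp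
  finally show ?thesis .
qed

lemma card_values_ge_2: "card (F ` \<Omega>) \<ge> 2"
proof -
  have "card {lo, hi} \<le> card (F ` \<Omega>)"
    using finite_space lo_in hi_in by (intro card_mono) auto
  then show ?thesis
    using lo_less_mean[of 0] mean_less_hi[of 0] by simp
qed

lemma is_exp_family_reduced: "is_exp_family (reduced_family E)"
proof -
  have "ef_alpha E 0 < ef_alpha E 1"
    using strict_mono_onD[OF ef_alpha_strict_mono[OF finite_space], of 0 1] card_values_ge_2 by simp
  moreover have "0 \<in> {..<card (F ` \<Omega>)}" "1 \<in> {..<card (F ` \<Omega>)}"
    using card_values_ge_2 by auto
  ultimately show ?thesis
    unfolding is_exp_family_def reduced_family_def constant_on_def
    by (metis exp_family.select_convs(1,3) finite_lessThan less_irrefl)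
qed

section \<open>The curvature of the binomial family\<close>

text \<open>This is the binomial \<open>ef_psi\<close> up to an affine change of parameter and an
  affine summand. Its derivatives are the mean, affine in the logistic function
  \<open>\<sigma>\<close>, and the Fisher metric, a multiple of
  \<open>\<sigma> * (1 - \<sigma>)\<close>.\<close>

lemma curvature_of_logistic_psi:
  assumes psi: "\<And>\<theta>. ef_psi E \<theta> = s + \<theta> * t + n * ln (1 + exp (d + \<theta> * b))"
    and "n > 0" "b \<noteq> 0"
  shows "scalar_curvature (tangent_bundle_metric E) z = 2 / n"
proof -
  define \<sigma> where "\<sigma> = (\<lambda>\<theta>. exp (d + \<theta> * b) / (1 + exp (d + \<theta> * b)))"
  have pos: "1 + exp u > 0" for u :: real
    by (simp add: add_pos_pos)
  have nz: "1 + exp u \<noteq> 0" for u :: real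
    using pos[of u] by simp
  have \<sigma>: "0 < \<sigma> \<theta>" "\<sigma> \<theta> < 1" for \<theta>
    unfolding \<sigma>_def using pos by simp_all
  have d\<sigma>: "(\<sigma> has_real_derivative b * \<sigma> \<theta> * (1 - \<sigma> \<theta>)) (at \<theta>)" for \<theta>
    unfolding \<sigma>_def by (rule derivative_eq_intros refl nz)+ (simp add: nz field_simps)
  have "(ef_psi E has_real_derivative t + n * b * \<sigma> \<theta>) (at \<theta>)" for \<theta>
    unfolding psi[abs_def] \<sigma>_def
    by (rule derivative_eq_intros refl pos)+ (simp add: nz field_simps)
  then have "\<mu> 1 = (\<lambda>\<theta>. t + n * b * \<sigma> \<theta>)"
    using DERIV_unique[OF DERIV_psi] by blast
  then have "(\<mu> 1 has_real_derivative n * b * (b * \<sigma> \<theta> * (1 - \<sigma> \<theta>))) (at \<theta>)" for \<theta>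
    by (auto intro!: derivative_eq_intros d\<sigma>)
  then have h: "h = (\<lambda>\<theta>. n * b\<^sup>2 * (\<sigma> \<theta> * (1 - \<sigma> \<theta>)))"
    using DERIV_unique[OF DERIV_mean] by (fastforce simp: power2_eq_square mult.assoc)
  have "((\<lambda>q. ln (h q)) has_real_derivative b * (1 - 2 * \<sigma> \<theta>)) (at \<theta>)" for \<theta>
  proof -
    have "\<sigma> \<theta> \<noteq> 0" "1 - \<sigma> \<theta> \<noteq> 0" "n * b\<^sup>2 * (\<sigma> \<theta> * (1 - \<sigma> \<theta>)) > 0"
      using \<sigma>[of \<theta>] assms(2,3) by auto
    then show ?thesis
      unfolding h using assms(2,3)
      by - ((rule derivative_eq_intros d\<sigma> refl | assumption)+, simp add: field_simps power2_eq_square)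
  qed
  then have "deriv (\<lambda>q. ln (h q)) = (\<lambda>\<theta>. b * (1 - 2 * \<sigma> \<theta>))"
    using DERIV_imp_deriv by blast
  \<comment> \<open>The derivative \<open>- 2 * b\<^sup>2 * \<sigma> * (1 - \<sigma>)\<close> is
    \<open>- (2 / n)\<close> times the Fisher metric.\<close>
  moreover have "((\<lambda>\<theta>. b * (1 - 2 * \<sigma> \<theta>)) has_real_derivative - (2 / n) * h \<theta>) (at \<theta>)" for \<theta>
    unfolding h using assms(2)
    by - ((rule derivative_eq_intros d\<sigma> refl)+, simp add: power2_eq_square)
  ultimately have "\<forall>\<theta>. deriv (deriv (\<lambda>q. ln (h q))) \<theta> = - (2 / n) * h \<theta>"
    using DERIV_imp_deriv by metis
  then show ?thesis
    using constant_curvature_iff by blast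
qed

end

section \<open>Equivalence of families\<close>

text \<open>The map sending \<open>\<theta>\<close> to \<open>d + \<theta> * b\<close> is a
  bijection of the parameters, and the summand \<open>s + \<theta> * t\<close>, independent of
  \<open>x\<close>, cancels on normalisation.\<close>

lemma ef_equiv_affine:
  assumes "is_exp_family E" "is_exp_family E'" "ef_space E = ef_space E'" "b \<noteq> 0"
    and C: "\<And>x. x \<in> ef_space E' \<Longrightarrow> ef_C E x = s + ef_C E' x + d * ef_F E' x"
    and F: "\<And>x. x \<in> ef_space E' \<Longrightarrow> ef_F E x = t + b * ef_F E' x"
  shows "ef_equiv E E'"
proof -
  have exp_eq: "exp (ef_C E x + \<theta> * ef_F E x)
      = exp (s + \<theta> * t) * exp (ef_C E' x + (d + \<theta> * b) * ef_F E' x)" if "x \<in> ef_space E'" for x \<theta>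
    using that by (simp add: C F algebra_simps flip: exp_add)
  then have "ef_partition E \<theta> = exp (s + \<theta> * t) * ef_partition E' (d + \<theta> * b)" for \<theta>
    unfolding ef_partition_def assms(3) by (simp add: sum_distrib_left)
  then have "restrict (ef_prob E \<theta>) (ef_space E) = restrict (ef_prob E' (d + \<theta> * b)) (ef_space E')"
    for \<theta>
    using exp_eq assms(1,2) by (auto simp: exp_fam.prob_eq exp_fam_def assms(3) fun_eq_iff)
  then have "ef_distributions E
      = (\<lambda>\<theta>. restrict (ef_prob E' \<theta>) (ef_space E')) ` range (\<lambda>\<theta>. d + \<theta> * b)"
    unfolding ef_distributions_def by (simp add: image_image)
  also have "range (\<lambda>\<theta>. d + \<theta> * b) = UNIV"
  proof (rule surjI)
    show "d + ((\<theta> - d) / b) * b = \<theta>" for \<theta>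
      using assms(4) by simp
  qed
  finally show ?thesis
    using assms(3) unfolding ef_equiv_def ef_distributions_def[of E'] by (intro conjI)
qed

lemma is_exp_family_binomial: "n > 0 \<Longrightarrow> is_exp_family (binomial_family n)"
proof -
  assume "n > 0"
  then have "0 \<in> {..n}" "1 \<in> {..n}"
    by auto
  then have "\<not> real constant_on {..n}"
    unfolding constant_on_def by (metis of_nat_eq_iff zero_neq_one)
  then show ?thesis
    by (simp add: is_exp_family_def binomial_family_def)
qed

text \<open>The log-densities at the points 0 and 1 are enough: the first expresses
  \<open>ef_psi\<close> through the binomial parameter \<open>\<eta>\<close>, and their difference
  makes \<open>\<eta>\<close> affine in \<open>\<theta>\<close>.\<close>

lemma ef_equiv_binomial_imp_psi:
  assumes "ef_equiv E (binomial_family n)" "n > 0"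
  shows "ef_psi E \<theta> = ef_C E 0 + \<theta> * ef_F E 0
    + real n * ln (1 + exp ((ef_C E 1 - ef_C E 0 - ln (real n)) + \<theta> * (ef_F E 1 - ef_F E 0)))"
proof -
  have space: "ef_space E = {..n}"
    using assms by (simp add: ef_equiv_def binomial_family_def)
  have "restrict (ef_prob E \<theta>) (ef_space E) \<in> ef_distributions (binomial_family n)"
    using assms by (auto simp: ef_equiv_def ef_distributions_def)
  then obtain \<eta> where \<eta>: "restrict (ef_prob E \<theta>) {..n} = restrict (ef_prob (binomial_family n) \<eta>) {..n}"
    unfolding ef_distributions_def space by (auto simp: binomial_family_def)
  have "ef_C E k + \<theta> * ef_F E k - ef_psi E \<theta>
      = ln (real (n choose k)) + \<eta> * real k - real n * ln (1 + exp \<eta>)" if "k \<le> n" for k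
    using fun_cong[OF \<eta>, of k] that ef_psi_binomial_family[of n \<eta>]
    by (simp add: ef_prob_def) (simp add: binomial_family_def)
  from this[of 0] this[of 1]
  have psi: "ef_psi E \<theta> = ef_C E 0 + \<theta> * ef_F E 0 + real n * ln (1 + exp \<eta>)"
    and "\<eta> = (ef_C E 1 - ef_C E 0 - ln (real n)) + \<theta> * (ef_F E 1 - ef_F E 0)"
    using assms(2) by (simp_all add: algebra_simps Suc_le_eq)
  then show ?thesis
    by simp
qed

theorem proposition8p8:
  fixes E :: "'a exp_family" and p :: nat
  assumes "is_exp_family E"
    and "card (ef_space (reduced_family E)) = p + 1"
  shows "(\<exists>c. \<forall>z. scalar_curvature (tangent_bundle_metric E) z = c)
     \<longleftrightarrow> ef_equiv (reduced_family E) (binomial_family p)"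
proof -
  interpret exp_fam E
    by unfold_locales fact
  let ?A = "ef_F E ` ef_space E"
  have card: "card ?A = p + 1"
    using assms(2) by (simp add: reduced_family_def)
  then have "p > 0"
    using card_values_ge_2 by simp
  interpret red: exp_fam "reduced_family E"
    by unfold_locales (fact is_exp_family_reduced)
  show ?thesis
  proof
    assume "\<exists>c. \<forall>z. scalar_curvature (tangent_bundle_metric E) z = c"
    then obtain c where "\<And>\<theta>. deriv (deriv (\<lambda>q. ln (h q))) \<theta> = - c * h \<theta>"
      unfolding constant_curvature_iff by blast
    then obtain \<beta> K where \<beta>: "\<beta> > 0" and K: "K > 0"
      and odds: "\<And>\<theta>. \<mu> 1 \<theta> - lo = K * exp (\<theta> * \<beta>) * (hi - \<mu> 1 \<theta>)"
      using mean_odds_exponential fisher_eq_logistic by metis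
    note rec = weight_recursion[OF odds]
    have \<alpha>: "ef_alpha E k = lo + real k * \<beta>" if "k \<le> p" for k
      using ef_alpha_eq_arith_progression[OF \<beta> K rec] that card by simp
    \<comment> \<open>The maximum has some index \<open>k \<le> p\<close>, which bounds it by
      \<open>lo + real p * \<beta>\<close>; the value at index \<open>p\<close> gives the reverse
      bound.\<close>
    have "hi \<in> ef_alpha E ` {..<p + 1}"
      using hi_in ef_alpha_image[OF finite_space] card by simp
    then obtain k where "k < p + 1" "hi = ef_alpha E k"
      by blast
    then have k: "k \<le> p" "hi = lo + real k * \<beta>"
      using \<alpha>[of k] by simp_all
    have "ef_alpha E p \<in> ?A"
      using ef_alpha_image[OF finite_space] card by force
    then have "lo + real p * \<beta> \<le> hi"
      using \<alpha>[of p] finite_space by simp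
    then have hi: "hi = lo + real p * \<beta>"
      using k \<beta> by simp
    show "ef_equiv (reduced_family E) (binomial_family p)"
    \<comment> \<open>The constants are \<open>s = ln (w lo)\<close>, \<open>d = ln K\<close>,
      \<open>t = lo\<close> and \<open>b = \<beta>\<close>: the power \<open>K ^ k\<close> becomes
      the linear term of the exponent.\<close>
    proof (rule ef_equiv_affine[OF red.fam is_exp_family_binomial])
      fix k assume "k \<in> ef_space (binomial_family p)"
      then have k: "k \<le> p"
        by (simp add: binomial_family_def)
      show "ef_F (reduced_family E) k = lo + \<beta> * ef_F (binomial_family p) k"
        using \<alpha>[OF k] by (simp add: reduced_family_def binomial_family_def)
      have "ef_omega E k = ln (w lo * K ^ k * real (p choose k))"
        unfolding ef_omega_def ef_weight_def[symmetric] \<alpha>[OF k]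
          weight_eq_binomial[OF \<beta> rec hi k] ..
      also have "\<dots> = ln (w lo) + ln (real (p choose k)) + ln K * real k"
        using weight_pos[OF lo_in] K k by (simp add: ln_mult ln_realpow)
      finally show "ef_C (reduced_family E) k
          = ln (w lo) + ef_C (binomial_family p) k + ln K * ef_F (binomial_family p) k"
        by (simp add: reduced_family_def binomial_family_def)
    qed (use \<open>p > 0\<close> \<beta> card in \<open>auto simp: reduced_family_def binomial_family_def\<close>)
  next
    assume equiv: "ef_equiv (reduced_family E) (binomial_family p)"
    \<comment> \<open>Only \<open>ef_psi\<close> has to be carried over to \<open>E\<close>, as its
      logistic shape determines the curvature.\<close>
    have "ef_psi E \<theta> = ef_psi (reduced_family E) \<theta>" for \<theta>
      by (simp add: psi_eq red.psi_eq partition_reduced)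
    note psi = this[unfolded ef_equiv_binomial_imp_psi[OF equiv \<open>p > 0\<close>]]
    \<comment> \<open>The slope of the binomial parameter in \<open>\<theta>\<close> is the gap
      between the two smallest values of \<open>F\<close>, hence nonzero.\<close>
    have "ef_alpha E 0 < ef_alpha E 1"
      using strict_mono_onD[OF ef_alpha_strict_mono[OF finite_space], of 0 1] card \<open>p > 0\<close> by simp
    then have "ef_F (reduced_family E) 1 - ef_F (reduced_family E) 0 \<noteq> 0"
      by (simp add: reduced_family_def)
    then have "\<forall>z. scalar_curvature (tangent_bundle_metric E) z = 2 / real p"
      using curvature_of_logistic_psi[OF psi] \<open>p > 0\<close> by simp
    then show "\<exists>c. \<forall>z. scalar_curvature (tangent_bundle_metric E) z = c" ..
  qed
qed

end
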